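(* Let $m_i>0$, let $\Pi_i\in\mathbb{R}^{3\times 3}$ be symmetric positive definite, let $h>0$, and let $\xi$ range over a finite index set, where to each $\xi$ are attached a vector $\mathbf{x}_{i\xi}\in\mathbb{R}^3$, a number $d_\xi>0$ and a number $\varphi_\xi^+(d_\xi)\ge 0$. Put $\mathbf{J}_{i\xi}=[\mathbf{I}_3,\ \mathbf{I}_3\otimes \mathbf{x}_{i\xi}^T]\in\mathbb{R}^{3\times 12}$, $\mathbf{M}_i=\mathrm{diag}(m_i\mathbf{I}_3,\Pi_i,\Pi_i,\Pi_i)\in\mathbb{R}^{12\times 12}$, and $$\mathbf{H}_i=\mathbf{M}_i+h^2\sum_\xi \frac{\varphi_\xi^+(d_\xi)}{d_\xi}\,\mathbf{J}_{i\xi}^T\mathbf{J}_{i\xi}.$$ Then $$\mathbf{H}_i=\begin{bmatrix} a_i\mathbf{I}_3 & \mathbf{e}_x\mathbf{b}_i^T & \mathbf{e}_y\mathbf{b}_i^T & \mathbf{e}_z\mathbf{b}_i^T\\ \mathbf{b}_i\mathbf{e}_x^T & \mathbf{D}_i & 0&0\\ \mathbf{b}_i\mathbf{e}_y^T&0&\mathbf{D}_i&0\\ \mathbf{b}_i\mathbf{e}_z^T&0&0&\mathbf{D}_i\end{bmatrix},$$ where $$a_i=m_i+h^2\sum_\xi\frac{\varphi_\xi^+(d_\xi)}{d_\xi},\qquad \mathbf{b}_i=h^2\sum_\xi\frac{\varphi_\xi^+(d_\xi)}{d_\xi}\mathbf{x}_{i\xi},\qquad \mathbf{D}_i=\Pi_i+h^2\sum_\xi\frac{\varphi_\xi^+(d_\xi)}{d_\xi}\mathbf{x}_{i\xi}\mathbf{x}_{i\xi}^T,$$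 and $\mathbf{H}_i$ is invertible with $$\mathbf{H}_i^{-1}=\begin{bmatrix} (a_i^{-1}+\tilde a_i)\mathbf{I}_3 & -\mathbf{e}_x\tilde{\mathbf{b}}_i^T\tilde{\mathbf{D}}_i^{-1} & -\mathbf{e}_y\tilde{\mathbf{b}}_i^T\tilde{\mathbf{D}}_i^{-1} & -\mathbf{e}_z\tilde{\mathbf{b}}_i^T\tilde{\mathbf{D}}_i^{-1}\\ -\tilde{\mathbf{D}}_i^{-1}\tilde{\mathbf{b}}_i\mathbf{e}_x^T & \tilde{\mathbf{D}}_i^{-1}&0&0\\ -\tilde{\mathbf{D}}_i^{-1}\tilde{\mathbf{b}}_i\mathbf{e}_y^T&0&\tilde{\mathbf{D}}_i^{-1}&0\\ -\tilde{\mathbf{D}}_i^{-1}\tilde{\mathbf{b}}_i\mathbf{e}_z^T&0&0&\tilde{\mathbf{D}}_i^{-1}\end{bmatrix},$$ where $$\tilde{\mathbf{b}}_i=\frac{\mathbf{b}_i}{a_i},\qquad \tilde{\mathbf{D}}_i=\mathbf{D}_i-\frac{\mathbf{b}_i\mathbf{b}_i^T}{a_i},\qquad \tilde a_i=\tilde{\mathbf{b}}_i^T\tilde{\mathbf{D}}_i^{-1}\tilde{\mathbf{b}}_i .$$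
   Context: All matrices are real and $12\times12$ matrices are written in $3\times3$ blocks. $\mathbf{e}_x,\mathbf{e}_y,\mathbf{e}_z\in\mathbb{R}^3$ are the standard basis column vectors, and $\mathbf{I}_3$ is the $3\times3$ identity. For $\mathbf{x}=(x,y,z)^T$, the matrix $\mathbf{J}=[\mathbf{I}_3,\mathbf{I}_3\otimes\mathbf{x}^T]$ is $$\begin{bmatrix}1&0&0&x&y&z&0&0&0&0&0&0\\0&1&0&0&0&0&x&y&z&0&0&0\\0&0&1&0&0&0&0&0&0&x&y&z\end{bmatrix}.$$ (In the application, $m_i$ and $\Pi_i$ are the mass and the second-moment matrix of body $i$, $h$ is a time step, $d_\xi$ is the length of a bond $\xi$ attached to body $i$ at material point $\mathbf{x}_{i\xi}$, and $\varphi_\xi^+$ is the nonnegative part in a splitting of the derivative of the bond energy; none of this interpretation is needed for the claim.) *)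

theory Defs
  imports "HOL-Analysis.Analysis"
begin

abbreviation e\<^sub>x :: "real^3" where "e\<^sub>x \<equiv> axis 1 1"
abbreviation e\<^sub>y :: "real^3" where "e\<^sub>y \<equiv> axis 2 1"
abbreviation e\<^sub>z :: "real^3" where "e\<^sub>z \<equiv> axis 3 1"

definition spd :: "real^'n^'n \<Rightarrow> bool" where
  "spd A \<longleftrightarrow> transpose A = A \<and> (\<forall>v. v \<noteq> 0 \<longrightarrow> v \<bullet> (A *v v) > 0)"

text \<open>The column-times-row product \<open>u v\<^sup>T\<close>.\<close>

definition outer :: "real^'m \<Rightarrow> real^'n \<Rightarrow> real^'n^'m" where
  "outer u v = (columnvector u :: real^1^'m) ** (rowvector v :: real^'n^1)"

text \<open>
  The indices \<open>1, \<dots>, 12\<close> of type \<open>12\<close> are split into four consecutive groups of three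
  (\<open>12\<close> is the element \<open>0\<close> of that type, but \<open>vector\<close> still enumerates it last).
\<close>

definition block_of :: "12 \<Rightarrow> 4" where
  "block_of k = (vector [1,1,1, 2,2,2, 3,3,3, 4,4,4] :: 4^12) $ k"

definition pos_of :: "12 \<Rightarrow> 3" where
  "pos_of k = (vector [1,2,3, 1,2,3, 1,2,3, 1,2,3] :: 3^12) $ k"

definition block_matrix :: "real^3^3^4^4 \<Rightarrow> real^12^12" where
  "block_matrix B = (\<chi> k l. B $ block_of k $ block_of l $ pos_of k $ pos_of l)"

text \<open>The matrix \<open>[I\<^sub>3, I\<^sub>3 \<otimes> x\<^sup>T]\<close>.\<close>

definition J_mat :: "real^3 \<Rightarrow> real^12^3" where
  "J_mat x = vector
    [vector [1, 0, 0,  x$1, x$2, x$3,  0, 0, 0,  0, 0, 0],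
     vector [0, 1, 0,  0, 0, 0,  x$1, x$2, x$3,  0, 0, 0],
     vector [0, 0, 1,  0, 0, 0,  0, 0, 0,  x$1, x$2, x$3]]"

text \<open>The matrix \<open>diag(m I\<^sub>3, P, P, P)\<close>.\<close>

definition M_mat :: "real \<Rightarrow> real^3^3 \<Rightarrow> real^12^12" where
  "M_mat m P = block_matrix (vector
    [vector [m *\<^sub>R mat 1, 0, 0, 0],
     vector [0, P, 0, 0],
     vector [0, 0, P, 0],
     vector [0, 0, 0, P]])"

lemma vector_4:
  "(vector [x,y,z,w] :: 'a::zero^4) $ 1 = x"
  "(vector [x,y,z,w] :: 'a::zero^4) $ 2 = y"
  "(vector [x,y,z,w] :: 'a::zero^4) $ 3 = z"
  "(vector [x,y,z,w] :: 'a::zero^4) $ 4 = w"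
  by (simp_all add: vector_def)

lemma vector_12:
  fixes l :: "'a::zero list"
  assumes "length l = 12"
  shows "(vector l :: 'a^12) $ 1 = l ! 0"
    and "(vector l :: 'a^12) $ 2 = l ! 1"
    and "(vector l :: 'a^12) $ 3 = l ! 2"
    and "(vector l :: 'a^12) $ 4 = l ! 3"
    and "(vector l :: 'a^12) $ 5 = l ! 4"
    and "(vector l :: 'a^12) $ 6 = l ! 5"
    and "(vector l :: 'a^12) $ 7 = l ! 6"
    and "(vector l :: 'a^12) $ 8 = l ! 7"
    and "(vector l :: 'a^12) $ 9 = l ! 8"
    and "(vector l :: 'a^12) $ 10 = l ! 9"
    and "(vector l :: 'a^12) $ 11 = l ! 10"
    and "(vector l :: 'a^12) $ 12 = l ! 11"
proof -
  obtain a1 a2 a3 a4 a5 a6 a7 a8 a9 a10 a11 a12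
    where l: "l = [a1,a2,a3,a4,a5,a6,a7,a8,a9,a10,a11,a12]"
    using assms by (auto simp: numeral_eq_Suc length_Suc_conv)
  show "(vector l :: 'a^12) $ 1 = l ! 0" "(vector l :: 'a^12) $ 2 = l ! 1"
    "(vector l :: 'a^12) $ 3 = l ! 2" "(vector l :: 'a^12) $ 4 = l ! 3"
    "(vector l :: 'a^12) $ 5 = l ! 4" "(vector l :: 'a^12) $ 6 = l ! 5"
    "(vector l :: 'a^12) $ 7 = l ! 6" "(vector l :: 'a^12) $ 8 = l ! 7"
    "(vector l :: 'a^12) $ 9 = l ! 8" "(vector l :: 'a^12) $ 10 = l ! 9"
    "(vector l :: 'a^12) $ 11 = l ! 10" "(vector l :: 'a^12) $ 12 = l ! 11"
    by (simp_all add: l vector_def)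
qed

lemma exhaust_12:
  fixes k :: 12
  shows "k = 1 \<or> k = 2 \<or> k = 3 \<or> k = 4 \<or> k = 5 \<or> k = 6 \<or>
         k = 7 \<or> k = 8 \<or> k = 9 \<or> k = 10 \<or> k = 11 \<or> k = 12"
proof (induct k)
  case (of_int z)
  then have "0 \<le> z" "z < 12" by simp_all
  then have "z = 0 \<or> z = 1 \<or> z = 2 \<or> z = 3 \<or> z = 4 \<or> z = 5 \<or> z = 6 \<or>
    z = 7 \<or> z = 8 \<or> z = 9 \<or> z = 10 \<or> z = 11" by arith
  then show ?case by auto
qed

lemma J_mat_blocks:
  "J_mat x = (\<chi> i k. (vector [mat 1, outer e\<^sub>x x, outer e\<^sub>y x, outer e\<^sub>z x] :: real^3^3^4)
      $ block_of k $ i $ pos_of k)"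
proof -
  have "J_mat x $ i $ k = (vector [mat 1, outer e\<^sub>x x, outer e\<^sub>y x, outer e\<^sub>z x] :: real^3^3^4)
      $ block_of k $ i $ pos_of k" for i k
    using exhaust_12[of k] exhaust_3[of i]
    by (elim disjE; simp add: J_mat_def block_of_def pos_of_def vector_12 vector_4 vector_3
        outer_def columnvector_def rowvector_def matrix_matrix_mult_def axis_def mat_def)
  then show ?thesis by (simp add: vec_eq_iff)
qed

end

theory Submission
  imports Defs
begin

text \<open>
  Block matrices multiply blockwise, so both formulas are identities between \<open>4 \<times> 4\<close> arrays of
  \<open>3 \<times> 3\<close> blocks. Invertibility of \<open>D - b b\<^sup>T / a\<close> comes from completing the square: with weights
  \<open>w\<close> and \<open>s = (b \<bullet> v) / a\<close>, its quadratic form at \<open>v\<close> is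
  \<open>v \<bullet> \<Pi> v + m s\<^sup>2 + (\<Sum>\<xi>. w \<xi> (x \<xi> \<bullet> v - s)\<^sup>2)\<close>.
\<close>

section \<open>Algebra of rank-one products\<close>

lemma outer_component [simp]: "outer u v $ i $ j = u $ i * v $ j"
  by (simp add: outer_def columnvector_def rowvector_def matrix_matrix_mult_def)

lemma transpose_outer: "transpose (outer u v) = outer v u"
  by (simp add: vec_eq_iff transpose_def)

lemma outer_mult_vector: "outer u v *v w = (v \<bullet> w) *\<^sub>R u"
  by (simp add: vec_eq_iff matrix_vector_mult_def inner_vec_def sum_distrib_left
      sum_distrib_right mult_ac)

lemma vector_mult_outer: "w v* outer u v = (w \<bullet> u) *\<^sub>R v"
  by (simp add: vec_eq_iff vector_matrix_mult_def inner_vec_def sum_distrib_left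
      sum_distrib_right mult_ac)

lemma matrix_mult_outer: "A ** outer u v = outer (A *v u) v"
  by (simp add: vec_eq_iff matrix_vector_mult_def matrix_matrix_mult_def sum_distrib_left
      sum_distrib_right mult_ac)

lemma outer_matrix_mult: "outer u v ** A = outer u (v v* A)"
  by (simp add: vec_eq_iff vector_matrix_mult_def matrix_matrix_mult_def sum_distrib_left
      sum_distrib_right mult_ac)

lemma outer_scaleR_left: "outer (c *\<^sub>R u) v = c *\<^sub>R outer u v"
  by (simp add: vec_eq_iff)

lemma outer_scaleR_right: "outer u (c *\<^sub>R v) = c *\<^sub>R outer u v"
  by (simp add: vec_eq_iff)

lemma outer_minus_left: "outer (- u) v = - outer u v"
  by (simp add: vec_eq_iff)

lemma outer_minus_right: "outer u (- v) = - outer u v"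
  by (simp add: vec_eq_iff)

lemma outer_sum_left: "outer (\<Sum>i\<in>I. f i) v = (\<Sum>i\<in>I. outer (f i) v)"
  by (simp add: vec_eq_iff sum_distrib_right)

lemma outer_sum_right: "outer u (\<Sum>i\<in>I. f i) = (\<Sum>i\<in>I. outer u (f i))"
  by (simp add: vec_eq_iff sum_distrib_left)

lemma outer_zero [simp]: "outer 0 v = 0" "outer u 0 = 0"
  by (simp_all add: vec_eq_iff)

lemma sum_matrix_vector_mult: "(\<Sum>i\<in>I. f i) *v v = (\<Sum>i\<in>I. f i *v v)"
  for f :: "'i \<Rightarrow> real^'n^'m"
  by (induction I rule: infinite_finite_induct) (simp_all add: matrix_vector_mult_add_rdistrib)

text \<open>Resolution of the identity; it turns the three rank-one terms in the top left block of
  the product in \<open>arrow_matrix_inverse\<close> into a multiple of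
  \<open>mat 1\<close>.\<close>

lemma sum_outer_axis: "outer e\<^sub>x e\<^sub>x + outer e\<^sub>y e\<^sub>y + outer e\<^sub>z e\<^sub>z = mat 1"
  by (simp add: vec_eq_iff forall_3 axis_def mat_def)

lemma matrix_mult_add_rdistrib: "(A + B) ** C = A ** C + B ** C"
  for A B :: "'a::semiring_1^'n^'m"
  by (simp add: vec_eq_iff matrix_matrix_mult_def distrib_right sum.distrib)

text \<open>\<open>matrix_inv\<close> chooses some two-sided inverse. For square matrices a right
  inverse is two-sided and hence unique, so one product determines the choice.\<close>

lemma matrix_inv_eqI:
  fixes A B :: "'a::field^'n^'n"
  assumes "A ** B = mat 1"
  shows "matrix_inv A = B"
  unfolding matrix_inv_def
proof (rule some_equality)
  show BA: "A ** B = mat 1 \<and> B ** A = mat 1"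
    using assms matrix_left_right_inverse by blast
  show "C = B" if "A ** C = mat 1 \<and> C ** A = mat 1" for C
    using that BA by (metis matrix_mul_assoc matrix_mul_lid matrix_mul_rid)
qed

text \<open>A nonzero kernel vector would make the quadratic form vanish, so the kernel is
  trivial.\<close>

lemma spd_imp_invertible:
  assumes "spd A"
  shows "invertible A"
proof -
  have "v = 0" if "A *v v = 0" for v
    using assms that unfolding spd_def by (metis inner_zero_right less_irrefl)
  then show ?thesis
    using matrix_left_invertible_ker invertible_left_inverse by blast
qed

section \<open>Passing from twelve indices to blocks\<close>

lemma bij_block_pos: "bij (\<lambda>k. (block_of k, pos_of k))"
proof -
  have "\<exists>k. block_of k = b \<and> pos_of k = p" for b p
  proof -
    have "block_of 1 = 1" "block_of 2 = 1" "block_of 3 = 1"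
      "block_of 4 = 2" "block_of 5 = 2" "block_of 6 = 2"
      "block_of 7 = 3" "block_of 8 = 3" "block_of 9 = 3"
      "block_of 10 = 4" "block_of 11 = 4" "block_of 12 = 4"
      "pos_of 1 = 1" "pos_of 2 = 2" "pos_of 3 = 3"
      "pos_of 4 = 1" "pos_of 5 = 2" "pos_of 6 = 3"
      "pos_of 7 = 1" "pos_of 8 = 2" "pos_of 9 = 3"
      "pos_of 10 = 1" "pos_of 11 = 2" "pos_of 12 = 3"
      unfolding block_of_def pos_of_def by (subst vector_12; simp)+
    with exhaust_4[of b] exhaust_3[of p] show ?thesis by metis
  qed
  then have "surj (\<lambda>k. (block_of k, pos_of k))"
    unfolding surj_def by (metis prod.exhaust)
  \<comment> \<open>Counting replaces a case check: a surjection between finite sets of equal size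
    12 = 4 * 3 is injective.\<close>
  moreover from this have "inj (\<lambda>k. (block_of k, pos_of k))"
    by (intro eq_card_imp_inj_on) (simp_all flip: UNIV_Times_UNIV add: card_cartesian_product)
  ultimately show ?thesis by (simp add: bij_def)
qed

lemma sum_block_pos: "(\<Sum>k\<in>UNIV. f (block_of k) (pos_of k)) = (\<Sum>b\<in>UNIV. \<Sum>p\<in>UNIV. f b p)"
proof -
  have "(\<Sum>k\<in>UNIV. f (block_of k) (pos_of k)) = (\<Sum>(b, p)\<in>UNIV. f b p)"
    using sum.reindex_bij_betw[OF bij_block_pos, of "\<lambda>(b, p). f b p"] by simp
  then show ?thesis
    by (simp add: sum.cartesian_product)
qed

lemma block_matrix_mult:
  "block_matrix A ** block_matrix B = block_matrix (\<chi> I K. \<Sum>J\<in>UNIV. A $ I $ J ** B $ J $ K)"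
proof -
  have "(\<Sum>l\<in>UNIV. A $ block_of k $ block_of l $ pos_of k $ pos_of l *
      B $ block_of l $ block_of n $ pos_of l $ pos_of n) =
    (\<Sum>b\<in>UNIV. \<Sum>p\<in>UNIV. A $ block_of k $ b $ pos_of k $ p * B $ b $ block_of n $ p $ pos_of n)"
    for k n
    by (rule sum_block_pos)
  then show ?thesis
    by (simp add: vec_eq_iff block_matrix_def matrix_matrix_mult_def)
qed

text \<open>The outer \<open>mat\<close> puts the 3x3 identity on the block diagonal. Injectivity of
  the index splitting excludes further ones off the scalar diagonal.\<close>

lemma block_matrix_one: "block_matrix (mat (mat 1)) = mat 1"
proof -
  have "k = l" if "block_of k = block_of l" "pos_of k = pos_of l" for k l
    using that bij_block_pos by (auto simp: bij_def inj_def)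
  then show ?thesis
    by (auto simp: vec_eq_iff block_matrix_def mat_def)
qed

lemma block_matrix_add: "block_matrix (A + B) = block_matrix A + block_matrix B"
  by (simp add: vec_eq_iff block_matrix_def)

lemma block_matrix_scaleR: "block_matrix (c *\<^sub>R A) = c *\<^sub>R block_matrix A"
  by (simp add: vec_eq_iff block_matrix_def)

lemma block_matrix_sum: "block_matrix (\<Sum>i\<in>I. f i) = (\<Sum>i\<in>I. block_matrix (f i))"
  by (simp add: vec_eq_iff block_matrix_def)

text \<open>Block arrowhead shape common to the mass matrix, each \<open>J^T J\<close>, their
  weighted sum and the claimed inverse. The arms are functions of the axis index, so each identity
  is stated once for all three axes.\<close>

definition arrow_matrix :: "real^3^3 \<Rightarrow> (3 \<Rightarrow> real^3^3) \<Rightarrow> (3 \<Rightarrow> real^3^3) \<Rightarrow> real^3^3 \<Rightarrow> real^3^3^4^4"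
  where "arrow_matrix A R C D = vector
    [vector [A, R 1, R 2, R 3],
     vector [C 1, D, 0, 0],
     vector [C 2, 0, D, 0],
     vector [C 3, 0, 0, D]]"

text \<open>With \<open>J\<close> viewed as a row of four blocks, block (I, K) of the product is the
  transpose of block I times block K. Orthonormality of the axes gives
  \<open>(e_p x^T)^T (e_q x^T) = (e_p . e_q) x x^T\<close>, which kills the off-diagonal blocks
  outside the arms.\<close>

lemma transpose_J_mult_J:
  "transpose (J_mat x) ** J_mat x = block_matrix
    (arrow_matrix (mat 1) (\<lambda>k. outer (axis k 1) x) (\<lambda>k. outer x (axis k 1)) (outer x x))"
proof -
  define B where "B = (vector [mat 1, outer e\<^sub>x x, outer e\<^sub>y x, outer e\<^sub>z x] :: real^3^3^4)"
  have "transpose (J_mat x) ** J_mat x = block_matrix (\<chi> I K. transpose (B $ I) ** B $ K)"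
    unfolding J_mat_blocks B_def[symmetric]
    by (simp add: vec_eq_iff block_matrix_def transpose_def matrix_matrix_mult_def)
  also have "(\<chi> I K. transpose (B $ I) ** B $ K) =
      arrow_matrix (mat 1) (\<lambda>k. outer (axis k 1) x) (\<lambda>k. outer x (axis k 1)) (outer x x)"
    \<comment> \<open>Fixing the index type to 4 stops extensionality at block level, so the 3x3
      blocks stay whole matrices.\<close>
    by (simp add: vec_eq_iff[where 'b=4] forall_4 arrow_matrix_def B_def vector_4 transpose_outer
        matrix_mult_outer outer_mult_vector vector_mult_outer inner_axis_axis transpose_mat)
  finally show ?thesis .
qed

lemma arrow_matrix_add:
  "arrow_matrix A R C D + arrow_matrix A' R' C' D' =
    arrow_matrix (A + A') (\<lambda>k. R k + R' k) (\<lambda>k. C k + C' k) (D + D')"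
  by (simp add: vec_eq_iff[where 'b=4] forall_4 arrow_matrix_def vector_4)

lemma arrow_matrix_scaleR:
  "c *\<^sub>R arrow_matrix A R C D =
    arrow_matrix (c *\<^sub>R A) (\<lambda>k. c *\<^sub>R R k) (\<lambda>k. c *\<^sub>R C k) (c *\<^sub>R D)"
  by (simp add: vec_eq_iff[where 'b=4] forall_4 arrow_matrix_def vector_4)

lemma arrow_matrix_sum:
  "(\<Sum>i\<in>I. arrow_matrix (A i) (R i) (C i) (D i)) =
    arrow_matrix (\<Sum>i\<in>I. A i) (\<lambda>k. \<Sum>i\<in>I. R i k) (\<lambda>k. \<Sum>i\<in>I. C i k) (\<Sum>i\<in>I. D i)"
  by (simp add: vec_eq_iff[where 'b=4] forall_4 arrow_matrix_def vector_4)

lemma arrow_matrix_inverse: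
  fixes D :: "real^3^3" and b :: "real^3"
  assumes "a \<noteq> 0" and tb: "tb = b /\<^sub>R a" and tD: "tD = D - outer b b /\<^sub>R a" and E: "tD ** E = mat 1"
  shows "block_matrix (arrow_matrix (a *\<^sub>R mat 1)
        (\<lambda>k. outer (axis k 1) b) (\<lambda>k. outer b (axis k 1)) D) **
      block_matrix (arrow_matrix ((inverse a + tb \<bullet> (E *v tb)) *\<^sub>R mat 1)
        (\<lambda>k. - (outer (axis k 1) tb ** E)) (\<lambda>k. - (E ** outer tb (axis k 1))) E) = mat 1"
    (is "block_matrix ?H ** block_matrix ?K = _")
proof -
  have b: "b = a *\<^sub>R tb"
    using \<open>a \<noteq> 0\<close> by (simp add: tb)
  have D: "D = tD + a *\<^sub>R outer tb tb"
    using \<open>a \<noteq> 0\<close> by (simp add: tD b outer_scaleR_left outer_scaleR_right)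
  \<comment> \<open>\<open>u\<close> is the column and \<open>w\<close> the row appearing in the
    arms of the inverse; symmetry of \<open>E\<close> is not assumed, so they are kept
    apart.\<close>
  define u w t where "u = - (E *v tb)" and "w = - (tb v* E)" and "t = tb \<bullet> (E *v tb)"
  have vector_scaleR_mult: "(c *\<^sub>R v) v* X = c *\<^sub>R (v v* X)" "v v* (c *\<^sub>R mat 1) = c *\<^sub>R v"
    for c :: real and v and X :: "real^3^3"
    by (simp_all add: vector_scaleR_matrix_ac scaleR_vector_matrix_assoc)
  have tbE: "tb v* E = - w" and tbu: "tb \<bullet> u = - t"
    by (simp_all add: w_def u_def t_def)
  have DE: "D ** E = mat 1 - a *\<^sub>R outer tb w"
    by (simp add: D matrix_mult_add_rdistrib E outer_matrix_mult tbE outer_minus_right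
        flip: scalar_matrix_assoc scaleR_matrix_vector_assoc)
  have "tD *v u = - tb"
    by (simp add: u_def vec.neg matrix_vector_mul_assoc E)
  then have Du: "D *v u = - (1 + a * t) *\<^sub>R tb"
    by (simp add: D matrix_vector_mult_add_rdistrib outer_mult_vector scaleR_diff_left tbu
        flip: scaleR_matrix_vector_assoc)
  have bE: "b v* E = - a *\<^sub>R w"
    by (simp add: b vector_scaleR_mult tbE)
  have bu: "b \<bullet> u = - a * t"
    by (simp add: b tbu)
  have K: "?K = arrow_matrix ((inverse a + t) *\<^sub>R mat 1)
      (\<lambda>k. outer (axis k 1) w) (\<lambda>k. outer u (axis k 1)) E"
    by (simp add: outer_matrix_mult matrix_mult_outer outer_minus_left outer_minus_right
        u_def w_def t_def)
  have outer_b: "outer b v = a *\<^sub>R outer tb v" for v :: "real^3"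
    by (simp add: b outer_scaleR_left)
  have diag: "c *\<^sub>R mat 1 - c' *\<^sub>R outer e\<^sub>x e\<^sub>x - c' *\<^sub>R outer e\<^sub>y e\<^sub>y - c' *\<^sub>R outer e\<^sub>z e\<^sub>z = (c - c') *\<^sub>R mat 1"
    for c c' :: real
    by (simp add: scaleR_diff_left flip: sum_outer_axis) (simp add: scaleR_add_right)
  \<comment> \<open>Four cancellations: the corner is \<open>(1 + a t) - a t\<close> times the
    identity; the row arm contains \<open>a w + b^T E = 0\<close>; the column arm contains
    \<open>(1/a + t) b + D u = 0\<close>; a lower diagonal block is \<open>a tb w^T + D E\<close>,
    the identity. Lower off-diagonal blocks vanish by orthogonality of the axes.\<close>
  have "(\<chi> I J. \<Sum>L\<in>UNIV. ?H $ I $ L ** ?K $ L $ J) = mat (mat 1)"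
    unfolding K
    by (simp add: vec_eq_iff[where 'b=4] forall_4 sum_4 arrow_matrix_def vector_4
        mat_def[where 'n=4] outer_matrix_mult matrix_mult_outer vector_mult_outer vector_scaleR_mult
        inner_axis_axis DE Du bE bu diag
        outer_mult_vector outer_scaleR_left outer_scaleR_right outer_minus_left
        outer_minus_right outer_b
        flip: scalar_matrix_assoc scaleR_matrix_vector_assoc)
      (simp add: \<open>a \<noteq> 0\<close> algebra_simps)
  then show ?thesis
    by (simp add: block_matrix_mult block_matrix_one)
qed

section \<open>Positive definiteness of the Schur complement\<close>

lemma spd_schur_complement:
  fixes w :: "'i \<Rightarrow> real" and x :: "'i \<Rightarrow> real^'n"
  assumes "m > 0" and P: "spd P" and w: "\<And>i. i \<in> I \<Longrightarrow> w i \<ge> 0"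
  defines "a \<equiv> m + (\<Sum>i\<in>I. w i)" and "b \<equiv> (\<Sum>i\<in>I. w i *\<^sub>R x i)"
  shows "spd (P + (\<Sum>i\<in>I. w i *\<^sub>R outer (x i) (x i)) - outer b b /\<^sub>R a)" (is "spd ?S")
  unfolding spd_def
proof (intro conjI allI impI)
  have "a > 0"
    using \<open>m > 0\<close> sum_nonneg[of I w] w by (auto simp: a_def)
  have "P $ j $ k = P $ k $ j" for j k
    using P unfolding spd_def by (metis transpose_def vec_lambda_beta)
  then show "transpose ?S = ?S"
    by (simp add: vec_eq_iff transpose_def mult_ac)
  fix v :: "real^'n"
  assume "v \<noteq> 0"
  define s where "s = (b \<bullet> v) / a"
  have bv: "(\<Sum>i\<in>I. w i * (x i \<bullet> v)) = a * s"
    using \<open>a > 0\<close> by (simp add: s_def b_def inner_sum_left)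
  have "v \<bullet> (?S *v v) = v \<bullet> (P *v v) + (\<Sum>i\<in>I. w i * (x i \<bullet> v)\<^sup>2) - (b \<bullet> v)\<^sup>2 / a"
    by (simp add: matrix_vector_mult_add_rdistrib matrix_vector_mult_diff_rdistrib
        sum_matrix_vector_mult outer_mult_vector inner_add_right inner_diff_right inner_sum_right
        power2_eq_square inner_commute divide_inverse mult_ac flip: scaleR_matrix_vector_assoc)
  also have "(b \<bullet> v)\<^sup>2 / a = a * s\<^sup>2"
    using \<open>a > 0\<close> by (simp add: s_def power2_eq_square)
  also have "v \<bullet> (P *v v) + (\<Sum>i\<in>I. w i * (x i \<bullet> v)\<^sup>2) - a * s\<^sup>2 =
      v \<bullet> (P *v v) + m * s\<^sup>2 + (\<Sum>i\<in>I. w i * (x i \<bullet> v - s)\<^sup>2)"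
  proof -
    \<comment> \<open>The weights sum to \<open>a - m\<close>, not \<open>a\<close>; this deficit is
      what the separate term \<open>m * s^2\<close> makes up.\<close>
    have "(\<Sum>i\<in>I. w i * (x i \<bullet> v - s)\<^sup>2) =
        (\<Sum>i\<in>I. w i * (x i \<bullet> v)\<^sup>2 - 2 * s * (w i * (x i \<bullet> v)) + w i * s\<^sup>2)"
      by (simp add: power2_diff algebra_simps)
    also have "\<dots> = (\<Sum>i\<in>I. w i * (x i \<bullet> v)\<^sup>2) - 2 * s * (a * s) + (a - m) * s\<^sup>2"
      by (simp add: sum.distrib sum_subtractf bv a_def flip: sum_distrib_left sum_distrib_right)
    finally show ?thesis
      by (simp add: power2_eq_square algebra_simps)
  qed
  \<comment> \<open>Strictness comes from the \<open>P\<close> term; the other two are only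
    nonnegative.\<close>
  also have "\<dots> > 0"
    using P \<open>v \<noteq> 0\<close> \<open>m > 0\<close> w unfolding spd_def
    by (intro add_pos_nonneg sum_nonneg mult_nonneg_nonneg) auto
  finally show "v \<bullet> (?S *v v) > 0" .
qed

theorem mainTheorem1:
  fixes m\<^sub>i h a\<^sub>i ta\<^sub>i :: real
    and \<Pi>\<^sub>i D\<^sub>i tD\<^sub>i :: "real^3^3"
    and b\<^sub>i tb\<^sub>i :: "real^3"
    and H\<^sub>i :: "real^12^12"
    and \<Xi> :: "'bond set"
    and x\<^sub>i :: "'bond \<Rightarrow> real^3"
    and d :: "'bond \<Rightarrow> real"
    and \<phi> :: "'bond \<Rightarrow> real \<Rightarrow> real"
  assumes "m\<^sub>i > 0" and "spd \<Pi>\<^sub>i" and "h > 0" and "finite \<Xi>"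
    and "\<And>\<xi>. \<xi> \<in> \<Xi> \<Longrightarrow> d \<xi> > 0"
    and "\<And>\<xi>. \<xi> \<in> \<Xi> \<Longrightarrow> \<phi> \<xi> (d \<xi>) \<ge> 0"
    and "H\<^sub>i = M_mat m\<^sub>i \<Pi>\<^sub>i +
           h\<^sup>2 *\<^sub>R (\<Sum>\<xi>\<in>\<Xi>. (\<phi> \<xi> (d \<xi>) / d \<xi>) *\<^sub>R (transpose (J_mat (x\<^sub>i \<xi>)) ** J_mat (x\<^sub>i \<xi>)))"
    and "a\<^sub>i = m\<^sub>i + h\<^sup>2 * (\<Sum>\<xi>\<in>\<Xi>. \<phi> \<xi> (d \<xi>) / d \<xi>)"
    and "b\<^sub>i = h\<^sup>2 *\<^sub>R (\<Sum>\<xi>\<in>\<Xi>. (\<phi> \<xi> (d \<xi>) / d \<xi>) *\<^sub>R x\<^sub>i \<xi>)"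
    and "D\<^sub>i = \<Pi>\<^sub>i + h\<^sup>2 *\<^sub>R (\<Sum>\<xi>\<in>\<Xi>. (\<phi> \<xi> (d \<xi>) / d \<xi>) *\<^sub>R outer (x\<^sub>i \<xi>) (x\<^sub>i \<xi>))"
    and "tb\<^sub>i = b\<^sub>i /\<^sub>R a\<^sub>i"
    and "tD\<^sub>i = D\<^sub>i - outer b\<^sub>i b\<^sub>i /\<^sub>R a\<^sub>i"
    and "ta\<^sub>i = tb\<^sub>i \<bullet> (matrix_inv tD\<^sub>i *v tb\<^sub>i)"
  shows "H\<^sub>i = block_matrix (vector
           [vector [a\<^sub>i *\<^sub>R mat 1, outer e\<^sub>x b\<^sub>i, outer e\<^sub>y b\<^sub>i, outer e\<^sub>z b\<^sub>i],
            vector [outer b\<^sub>i e\<^sub>x, D\<^sub>i, 0, 0],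
            vector [outer b\<^sub>i e\<^sub>y, 0, D\<^sub>i, 0],
            vector [outer b\<^sub>i e\<^sub>z, 0, 0, D\<^sub>i]])
    \<and> a\<^sub>i \<noteq> 0
    \<and> invertible tD\<^sub>i
    \<and> invertible H\<^sub>i
    \<and> matrix_inv H\<^sub>i = block_matrix (vector
           [vector [(inverse a\<^sub>i + ta\<^sub>i) *\<^sub>R mat 1,
                    - (outer e\<^sub>x tb\<^sub>i ** matrix_inv tD\<^sub>i),
                    - (outer e\<^sub>y tb\<^sub>i ** matrix_inv tD\<^sub>i),
                    - (outer e\<^sub>z tb\<^sub>i ** matrix_inv tD\<^sub>i)],
            vector [- (matrix_inv tD\<^sub>i ** outer tb\<^sub>i e\<^sub>x), matrix_inv tD\<^sub>i, 0, 0],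
            vector [- (matrix_inv tD\<^sub>i ** outer tb\<^sub>i e\<^sub>y), 0, matrix_inv tD\<^sub>i, 0],
            vector [- (matrix_inv tD\<^sub>i ** outer tb\<^sub>i e\<^sub>z), 0, 0, matrix_inv tD\<^sub>i]])"
proof -
  \<comment> \<open>Absorbing \<open>h^2\<close> into the weights makes \<open>a\<close>,
    \<open>b\<close> and \<open>D\<close> plain weighted sums, as in
    \<open>spd_schur_complement\<close>.\<close>
  define w where "w \<xi> = h\<^sup>2 * (\<phi> \<xi> (d \<xi>) / d \<xi>)" for \<xi>
  have w: "w \<xi> \<ge> 0" if "\<xi> \<in> \<Xi>" for \<xi>
    using that assms(5,6)[of \<xi>] by (simp add: w_def)
  have a: "a\<^sub>i = m\<^sub>i + (\<Sum>\<xi>\<in>\<Xi>. w \<xi>)"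
    by (simp add: assms(8) w_def sum_distrib_left)
  have b: "b\<^sub>i = (\<Sum>\<xi>\<in>\<Xi>. w \<xi> *\<^sub>R x\<^sub>i \<xi>)"
    by (simp add: assms(9) w_def scaleR_right.sum)
  have D: "D\<^sub>i = \<Pi>\<^sub>i + (\<Sum>\<xi>\<in>\<Xi>. w \<xi> *\<^sub>R outer (x\<^sub>i \<xi>) (x\<^sub>i \<xi>))"
    by (simp add: assms(10) w_def scaleR_right.sum)
  have "a\<^sub>i > 0"
    using \<open>m\<^sub>i > 0\<close> sum_nonneg[of \<Xi> w] w by (auto simp: a)
  have "spd tD\<^sub>i"
    unfolding assms(12) a b D by (rule spd_schur_complement[OF assms(1,2)]) (rule w)
  then have inv: "invertible tD\<^sub>i"
    by (rule spd_imp_invertible)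
  then have E: "tD\<^sub>i ** matrix_inv tD\<^sub>i = mat 1"
    by (auto simp: invertible_right_inverse dest: matrix_inv_eqI)
  \<comment> \<open>The mass matrix is an arrowhead with zero arms, so all of \<open>H\<close> can
    be summed inside \<open>arrow_matrix\<close>.\<close>
  have "M_mat m\<^sub>i \<Pi>\<^sub>i = block_matrix (arrow_matrix (m\<^sub>i *\<^sub>R mat 1) (\<lambda>k. 0) (\<lambda>k. 0) \<Pi>\<^sub>i)"
    by (simp add: M_mat_def arrow_matrix_def)
  then have H: "H\<^sub>i = block_matrix (arrow_matrix (a\<^sub>i *\<^sub>R mat 1)
      (\<lambda>k. outer (axis k 1) b\<^sub>i) (\<lambda>k. outer b\<^sub>i (axis k 1)) D\<^sub>i)"
    by (simp add: assms(7) transpose_J_mult_J scaleR_right.sum w_def a b D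
        arrow_matrix_add arrow_matrix_scaleR arrow_matrix_sum outer_sum_left outer_sum_right
        outer_scaleR_left outer_scaleR_right scaleR_add_left scaleR_sum_left
        flip: block_matrix_add block_matrix_scaleR block_matrix_sum)
  define K where "K = block_matrix (arrow_matrix ((inverse a\<^sub>i + ta\<^sub>i) *\<^sub>R mat 1)
      (\<lambda>k. - (outer (axis k 1) tb\<^sub>i ** matrix_inv tD\<^sub>i))
      (\<lambda>k. - (matrix_inv tD\<^sub>i ** outer tb\<^sub>i (axis k 1))) (matrix_inv tD\<^sub>i))"
  have HK: "H\<^sub>i ** K = mat 1"
    unfolding H K_def assms(13)
    using \<open>a\<^sub>i > 0\<close> by (intro arrow_matrix_inverse[OF _ assms(11,12) E]) simp
  then have "invertible H\<^sub>i"
    by (auto simp: invertible_right_inverse)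
  moreover have "matrix_inv H\<^sub>i = K"
    using HK by (rule matrix_inv_eqI)
  ultimately show ?thesis
    using H \<open>a\<^sub>i > 0\<close> inv by (simp add: arrow_matrix_def K_def)
qed

end
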